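(* Let $X$ be a real Hilbert space and suppose that $U,V\subset X$ are closed subspaces such that $U\cap V=\{0\}$ and $U+V$ is closed. Let $\{A_n\}$ and $\{B_n\}$ be two sequences of nonempty closed convex subsets of $X$ such that $A_n\to U$ and $B_n\to V$ for the Attouch-Wets convergence. Then, for each $a_0\in X$, the corresponding perturbed alternating projections sequences $\{a_n\}$ and $\{b_n\}$ (with respect to $\{A_n\}$ and $\{B_n\}$ and with starting point $a_0$) converge to $0$ in norm.
   Context: For a nonempty closed convex set $K\subset X$, $P_K$ denotes the metric projection onto $K$. Perturbed alternating projections sequences: given $a_0\in X$ and sequences $\{A_n\},\{B_n\}$ of nonempty closed convex sets, they are defined inductively by $b_n=P_{B_n}(a_{n-1})$ and $a_n=P_{A_n}(b_n)$ for $n\in\mathbb{N}=\{1,2,\dots\}$. Attouch-Wets convergence: let $B_X$ be the closed unit ball. For nonempty closed $A,C\subset X$ and $N\in\mathbb{N}$ put $e_N(A,C)=\sup\{\mathrm{dist}(a,C): a\in A,\ \|a\|\le N\}$ (equal to $0$ if $A\cap NB_X=\emptyset$) and $h_N(A,C)=\max\{e_N(A,C),e_N(C,A)\}$. A sequence $\{A_n\}$ of nonempty closed sets Attouch-Wets converges to the nonempty closed set $A$ if $\lim_n h_N(A_n,A)=0$ for every $N\in\mathbb{N}$. *)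

theory Defs
  imports "HOL-Analysis.Analysis"
begin

text \<open>The library's \<open>closest_point\<close> is restricted to Heine-Borel (hence finite-dimensional)
  spaces. On a nonempty closed convex subset of a Hilbert space the nearest point exists and
  is unique; elsewhere the value may be unspecified.\<close>

definition metric_projection :: "'a::metric_space set \<Rightarrow> 'a \<Rightarrow> 'a" where
  "metric_projection K x = (THE y. y \<in> K \<and> (\<forall>z\<in>K. dist x y \<le> dist x z))"

text \<open>For nonempty \<open>C\<close> the set whose supremum is taken is bounded above, by
  \<open>N + infdist 0 C\<close>, so the real-valued supremum is the genuine one.\<close>

definition aw_excess :: "nat \<Rightarrow> 'a::real_normed_vector set \<Rightarrow> 'a set \<Rightarrow> real" where
  "aw_excess N A C =
     (if {a \<in> A. norm a \<le> real N} = {} then 0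
      else (SUP a\<in>{a \<in> A. norm a \<le> real N}. infdist a C))"

definition aw_dist :: "nat \<Rightarrow> 'a::real_normed_vector set \<Rightarrow> 'a set \<Rightarrow> real" where
  "aw_dist N A C = max (aw_excess N A C) (aw_excess N C A)"

text \<open>Meaningful for nonempty closed sets, which are assumed separately wherever this is used.\<close>

definition attouch_wets_converges ::
    "(nat \<Rightarrow> 'a::real_normed_vector set) \<Rightarrow> 'a set \<Rightarrow> bool" where
  "attouch_wets_converges A L \<longleftrightarrow> (\<forall>N\<ge>1. (\<lambda>n. aw_dist N (A n) L) \<longlonglongrightarrow> 0)"

text \<open>The set sequences are indexed from 1; \<open>A 0\<close>, \<open>B 0\<close> and \<open>b 0\<close> play no role.\<close>

definition perturbed_alternating_projections ::
    "(nat \<Rightarrow> 'a::metric_space set) \<Rightarrow> (nat \<Rightarrow> 'a set) \<Rightarrow> 'a \<Rightarrow>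
     (nat \<Rightarrow> 'a) \<Rightarrow> (nat \<Rightarrow> 'a) \<Rightarrow> bool" where
  "perturbed_alternating_projections A B a0 a b \<longleftrightarrow>
     a 0 = a0 \<and>
     (\<forall>n\<ge>1. b n = metric_projection (B n) (a (n - 1)) \<and>
            a n = metric_projection (A n) (b n))"

end

theory Submission
  imports Defs
begin

text \<open>
  Since \<open>U + V\<close> is closed and \<open>U \<inter> V = {0}\<close>, the open mapping principle bounds the
  projection \<open>u + v \<mapsto> u\<close>; hence the angle between \<open>U\<close> and \<open>V\<close> is positive: there
  is \<open>\<gamma> < 1\<close> with \<open>u \<bullet> v \<le> \<gamma> \<parallel>u\<parallel> \<parallel>v\<parallel>\<close> (lemma \<open>positive_angle\<close>).

  Attouch-Wets convergence only controls \<open>A n\<close> on bounded sets, so boundedness of the iterates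
  is the difficulty. Convexity removes it. A large point \<open>x\<close> of \<open>A n\<close> can be pulled back
  into the unit ball along the segment to a point of \<open>A n\<close> near the origin, and rescaling shows
  that \<open>x\<close> is close to \<open>U\<close> relative to its norm. Thus, for given \<open>\<delta>, \<epsilon> > 0\<close> and
  all large \<open>n\<close>, every \<open>x \<in> A n\<close> lies within \<open>\<delta> max(\<parallel>x\<parallel>, \<epsilon>)\<close> of \<open>U\<close>, and
  \<open>A n\<close> contains a point \<open>p\<close> with \<open>\<parallel>p\<parallel> \<le> \<delta> \<epsilon>\<close>
  (lemma \<open>attouch_wets_subspace_cone\<close>).

  If now \<open>x\<close> is the projection onto \<open>A n\<close> of a point \<open>y \<in> B m\<close>, with \<open>m\<close> and
  \<open>n\<close> large, the variational inequality
  \<open>(y - x) \<bullet> (p - x) \<le> 0\<close> together with the angle bound gives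
  \<open>\<parallel>x\<parallel>\<^sup>2 \<le> q max(\<parallel>x\<parallel>, \<epsilon>) max(\<parallel>y\<parallel>, \<epsilon>)\<close> with \<open>q = \<gamma> + 8\<delta> < 1\<close>, that is
  \<open>\<parallel>x\<parallel> \<le> max(\<epsilon>, q \<parallel>y\<parallel>)\<close> (lemma \<open>projection_step_bound\<close>).
  The same holds with the roles exchanged, so the norms eventually decay geometrically until
  they are at most \<open>\<epsilon>\<close>, and stay there.
\<close>

section \<open>The metric projection in a Hilbert space\<close>

lemma nearest_point_exists:
  fixes K :: "'a::{real_inner, complete_space} set"
  assumes "K \<noteq> {}" "closed K" "convex K"
  shows "\<exists>y\<in>K. \<forall>z\<in>K. dist x y \<le> dist x z"
proof -
  define d where "d = infdist x K"
  have d0: "0 \<le> d" unfolding d_def by (rule infdist_nonneg)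
  have dle: "d \<le> norm (x - z)" if "z \<in> K" for z
    using infdist_le[OF that, of x] by (simp add: d_def dist_norm)
  have "\<exists>y\<in>K. (norm (x - y))\<^sup>2 < d\<^sup>2 + inverse (real (Suc n))" for n
  proof (rule ccontr)
    assume "\<not> ?thesis"
    then have "\<And>y. y \<in> K \<Longrightarrow> sqrt (d\<^sup>2 + inverse (real (Suc n))) \<le> dist x y"
      by (auto simp: not_less dist_norm intro: real_le_lsqrt)
    then have "sqrt (d\<^sup>2 + inverse (real (Suc n))) \<le> d"
      unfolding d_def infdist_notempty[OF assms(1)]
      by (intro cINF_greatest assms(1)) (auto simp: d_def infdist_notempty[OF assms(1)])
    then have "d\<^sup>2 + inverse (real (Suc n)) \<le> d\<^sup>2"
      using real_sqrt_le_iff[of "d\<^sup>2 + inverse (real (Suc n))" "d\<^sup>2"] d0 by simp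
    then show False by (simp add: not_le[symmetric])
  qed
  then obtain y where yK: "\<And>n. y n \<in> K"
    and yd: "\<And>n. (norm (x - y n))\<^sup>2 < d\<^sup>2 + inverse (real (Suc n))"
    by metis
  have par: "(norm (s - t))\<^sup>2 \<le> 2 * ((norm (x - s))\<^sup>2 - d\<^sup>2) + 2 * ((norm (x - t))\<^sup>2 - d\<^sup>2)"
    if "s \<in> K" "t \<in> K" for s t
  proof -
    \<comment> \<open>Parallelogram law: the midpoint of \<open>s\<close> and \<open>t\<close> lies in \<open>K\<close>, at distance at least \<open>d\<close>.\<close>
    let ?m = "(1/2) *\<^sub>R s + (1/2) *\<^sub>R t"
    have "?m \<in> K" using convexD[OF assms(3) that, of "1/2" "1/2"] by simp
    then have "d\<^sup>2 \<le> (norm (x - ?m))\<^sup>2" using dle d0 by (intro power_mono) auto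
    moreover have "(norm (s - t))\<^sup>2
        = 2 * (norm (x - s))\<^sup>2 + 2 * (norm (x - t))\<^sup>2 - 4 * (norm (x - ?m))\<^sup>2"
      unfolding power2_norm_eq_inner
      by (simp add: inner_commute algebra_simps)
    ultimately show ?thesis by simp
  qed
  have "Cauchy y"
  proof (rule metric_CauchyI)
    fix e :: real assume e: "0 < e"
    obtain N where N: "inverse (real (Suc N)) < e\<^sup>2 / 4"
      using reals_Archimedean[of "e\<^sup>2 / 4"] e by auto
    have "dist (y m) (y n) < e" if "m \<ge> N" "n \<ge> N" for m n
    proof -
      have "inverse (real (Suc m)) \<le> inverse (real (Suc N))"
        "inverse (real (Suc n)) \<le> inverse (real (Suc N))"
        using that by (auto intro!: le_imp_inverse_le)
      then have "(norm (y m - y n))\<^sup>2 < e\<^sup>2"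
        using par[OF yK[of m] yK[of n]] yd[of m] yd[of n] N by argo
      then show ?thesis using e by (simp add: dist_norm power_less_imp_less_base)
    qed
    then show "\<exists>M. \<forall>m\<ge>M. \<forall>n\<ge>M. dist (y m) (y n) < e" by blast
  qed
  then obtain l where l: "y \<longlonglongrightarrow> l"
    using Cauchy_convergent convergent_def by blast
  have lK: "l \<in> K" using closed_sequentially[OF assms(2)] yK l by blast
  have "(\<lambda>n. d\<^sup>2 + inverse (real (Suc n))) \<longlonglongrightarrow> d\<^sup>2 + 0"
    by (intro tendsto_intros LIMSEQ_inverse_real_of_nat)
  moreover have "(\<lambda>n. (norm (x - y n))\<^sup>2) \<longlonglongrightarrow> (norm (x - l))\<^sup>2"
    by (intro tendsto_intros l)
  ultimately have "(norm (x - l))\<^sup>2 \<le> d\<^sup>2 + 0"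
    using yd by (intro LIMSEQ_le[of "\<lambda>n. (norm (x - y n))\<^sup>2"]) (auto intro: less_imp_le)
  then have "norm (x - l) \<le> d" using power2_le_imp_le[OF _ d0] by simp
  then show ?thesis using lK dle by (force simp: dist_norm)
qed

lemma metric_projection_variational:
  fixes K :: "'a::{real_inner, complete_space} set"
  assumes "K \<noteq> {}" "closed K" "convex K"
  shows "metric_projection K x \<in> K"
    and "z \<in> K \<Longrightarrow> (x - metric_projection K x) \<bullet> (z - metric_projection K x) \<le> 0"
proof -
  have "\<exists>!y. y \<in> K \<and> (\<forall>z\<in>K. dist x y \<le> dist x z)"
    using nearest_point_exists[OF assms, of x] any_closest_point_unique[OF assms(3,2)] by blast
  from theI'[OF this]
  have *: "metric_projection K x \<in> K" "\<forall>z\<in>K. dist x (metric_projection K x) \<le> dist x z"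
    unfolding metric_projection_def by auto
  show "metric_projection K x \<in> K" by (fact *)
  show "(x - metric_projection K x) \<bullet> (z - metric_projection K x) \<le> 0" if "z \<in> K"
    by (rule any_closest_point_dot[OF assms(3,2) *(1) that *(2)])
qed

section \<open>Complemented sums and the angle between subspaces\<close>

text \<open>The Baire category step of the open mapping theorem, for the addition map
  \<open>U \<times> V \<rightarrow> U + V\<close>. Completeness of \<open>U + V\<close> is what matters here; the
  decomposition is only approximate, with an error of at most half the norm.\<close>

lemma approximate_decomposition:
  fixes U V :: "'a::{real_normed_vector, complete_space} set"
  assumes "subspace U" "subspace V" "closed {u + v | u v. u \<in> U \<and> v \<in> V}"
  shows "\<exists>K\<ge>0. \<forall>w\<in>{u + v | u v. u \<in> U \<and> v \<in> V}.
    \<exists>u\<in>U. \<exists>v\<in>V. norm u \<le> K * norm w \<and> norm (w - u - v) \<le> norm w / 2"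
proof -
  define W where "W = {u + v | u v. u \<in> U \<and> v \<in> V}"
  have cW: "closed W" and sW: "subspace W"
    using assms(3) subspace_sums[OF assms(1,2)] by (auto simp: W_def)
  define F where "F n = closure {u + v | u v. u \<in> U \<and> v \<in> V \<and> norm u \<le> real n}" for n
  have FW: "F n \<subseteq> W" for n
    unfolding F_def by (rule closure_minimal[OF _ cW]) (auto simp: W_def)
  have UF: "(\<Union>n. F n) = W"
  proof
    show "W \<subseteq> (\<Union>n. F n)"
    proof
      fix w assume "w \<in> W"
      then obtain u v where uv: "w = u + v" "u \<in> U" "v \<in> V" by (auto simp: W_def)
      obtain n where "norm u \<le> real n" using real_arch_simple by blast
      then have "w \<in> F n" unfolding F_def using uv by (intro subsetD[OF closure_subset]) blast
      then show "w \<in> (\<Union>n. F n)" by blast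
    qed
  qed (use FW in blast)
  have cm: "completely_metrizable_space (top_of_set W)"
    using cW completely_metrizable_space_closedin[OF completely_metrizable_space_euclidean] by simp
  have "\<exists>n. top_of_set W interior_of F n \<noteq> {}"
  proof (rule ccontr)
    assume "\<not> ?thesis"
    then have "top_of_set W interior_of \<Union>(range F) = {}"
      by (intro Baire_category_alt disjI1[OF cm])
        (auto simp: F_def intro!: closed_subset FW[unfolded F_def])
    then have "W = {}" using interior_of_topspace[of "top_of_set W"] UF by simp
    then show False using subspace_0[OF sW] by blast
  qed
  then obtain n w0 T where T: "openin (top_of_set W) T" "T \<subseteq> F n" "w0 \<in> T"
    by (auto simp: interior_of_def)
  then obtain r where r: "r > 0" "ball w0 r \<inter> W \<subseteq> F n" and w0: "w0 \<in> W"
    unfolding openin_contains_ball by blast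
  have near: "\<exists>u\<in>U. \<exists>v\<in>V. norm u \<le> real n \<and> norm (w - u - v) \<le> e"
    if w: "w \<in> W" "norm w < r" and e: "e > 0" for w e
  proof -
    have "w0 + w \<in> F n" "w0 - w \<in> F n"
      using r(2) w w0 sW by (auto simp: subset_iff dist_norm subspace_add subspace_diff)
    then obtain u1 v1 u2 v2 where
      1: "u1 \<in> U" "v1 \<in> V" "norm u1 \<le> real n" "dist (u1 + v1) (w0 + w) < e" and
      2: "u2 \<in> U" "v2 \<in> V" "norm u2 \<le> real n" "dist (u2 + v2) (w0 - w) < e"
      unfolding F_def closure_approachable using e by blast
    \<comment> \<open>The unknown centre \<open>w0\<close> cancels in half the difference.\<close>
    let ?u = "(1/2) *\<^sub>R (u1 - u2)" and ?v = "(1/2) *\<^sub>R (v1 - v2)"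
    have "w - ?u - ?v = (1/2) *\<^sub>R (((u2 + v2) - (w0 - w)) - ((u1 + v1) - (w0 + w)))"
      by (simp add: algebra_simps flip: scaleR_add_left)
    then have "norm (w - ?u - ?v) \<le> e"
      using 1(4) 2(4) norm_triangle_ineq4[of "(u2 + v2) - (w0 - w)" "(u1 + v1) - (w0 + w)"]
      by (simp add: dist_norm)
    moreover have "norm ?u \<le> real n"
      using norm_triangle_ineq4[of u1 u2] 1(3) 2(3) by simp
    moreover have "?u \<in> U" "?v \<in> V"
      using 1 2 assms(1,2) by (auto intro: subspace_mul subspace_diff)
    ultimately show ?thesis by blast
  qed
  have "\<exists>u\<in>U. \<exists>v\<in>V. norm u \<le> (2 * real n / r) * norm w \<and> norm (w - u - v) \<le> norm w / 2"
    if w: "w \<in> W" for w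
  proof (cases "w = 0")
    case True
    then show ?thesis using subspace_0[OF assms(1)] subspace_0[OF assms(2)] by force
  next
    case False
    define s where "s = r / (2 * norm w)"
    have s: "s > 0" using False r by (simp add: s_def)
    have "norm (s *\<^sub>R w) < r" using False r by (simp add: s_def)
    then obtain u v where uv: "u \<in> U" "v \<in> V" "norm u \<le> real n"
      "norm (s *\<^sub>R w - u - v) \<le> s * norm w / 2"
      using near[of "s *\<^sub>R w" "s * norm w / 2"] w subspace_mul[OF sW] s False by auto
    let ?u = "(1/s) *\<^sub>R u" and ?v = "(1/s) *\<^sub>R v"
    have nu: "norm ?u \<le> (2 * real n / r) * norm w"
      using uv(3) r False by (simp add: s_def field_simps)
    have "w - ?u - ?v = (1/s) *\<^sub>R (s *\<^sub>R w - u - v)"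
      using s by (simp add: scaleR_diff_right)
    then have "norm (w - ?u - ?v) = (1/s) * norm (s *\<^sub>R w - u - v)" using s by simp
    also have "\<dots> \<le> (1/s) * (s * norm w / 2)" using uv(4) s by (intro mult_left_mono) auto
    finally have "norm (w - ?u - ?v) \<le> norm w / 2" using s by simp
    moreover have "?u \<in> U" "?v \<in> V" using uv assms(1,2) by (auto intro: subspace_mul)
    ultimately show ?thesis using nu by blast
  qed
  moreover have "0 \<le> 2 * real n / r" using r by simp
  ultimately show ?thesis unfolding W_def by blast
qed

lemma geometric_increments_converge:
  fixes S :: "nat \<Rightarrow> 'a::{real_normed_vector, complete_space}"
  assumes "\<And>k. norm (S (Suc k) - S k) \<le> C / 2 ^ k"
  shows "\<exists>l. S \<longlonglongrightarrow> l \<and> norm (l - S 0) \<le> 2 * C"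
proof -
  have C: "0 \<le> C" using order_trans[OF norm_ge_zero assms[of 0]] by simp
  have tele: "norm (S (m + k) - S m) \<le> 2 * C / 2 ^ m - 2 * C / 2 ^ (m + k)" for m k
  proof (induction k)
    case (Suc k)
    have "norm (S (m + Suc k) - S m) \<le> norm (S (m + Suc k) - S (m + k)) + norm (S (m + k) - S m)"
      using norm_triangle_ineq[of "S (m + Suc k) - S (m + k)" "S (m + k) - S m"] by simp
    also have "\<dots> \<le> C / 2 ^ (m + k) + (2 * C / 2 ^ m - 2 * C / 2 ^ (m + k))"
      using assms[of "m + k"] Suc by simp
    also have "\<dots> = 2 * C / 2 ^ m - 2 * C / 2 ^ (m + Suc k)" by (simp add: field_simps)
    finally show ?case .
  qed simp
  have bound: "norm (S n - S m) \<le> 2 * C / 2 ^ m" if "m \<le> n" for m n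
  proof -
    obtain k where "n = m + k" using le_Suc_ex[OF \<open>m \<le> n\<close>] by blast
    moreover have "0 \<le> 2 * C / 2 ^ (m + k)" using C by simp
    ultimately show ?thesis using tele[of m k] by simp
  qed
  have "Cauchy S"
  proof (rule CauchyI')
    fix e :: real assume e: "0 < e"
    have "(\<lambda>m. 2 * C / 2 ^ m) \<longlonglongrightarrow> 0"
      by (rule LIMSEQ_divide_realpow_zero) simp
    then obtain M where "2 * C / 2 ^ M < e"
      using e order_tendstoD(2) eventually_sequentially by (metis order_refl)
    moreover have "2 * C / 2 ^ m \<le> 2 * C / 2 ^ M" if "m \<ge> M" for m
      using that C by (intro divide_left_mono power_increasing) auto
    ultimately have "norm (S m - S n) < e" if "m \<ge> M" "n > m" for m n
      using bound[of m n] that by (fastforce simp: norm_minus_commute)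
    then show "\<exists>M. \<forall>m\<ge>M. \<forall>n>m. dist (S m) (S n) < e" unfolding dist_norm by blast
  qed
  then obtain l where l: "S \<longlonglongrightarrow> l" using Cauchy_convergent convergent_def by blast
  have "(\<lambda>n. norm (S n - S 0)) \<longlonglongrightarrow> norm (l - S 0)" by (intro tendsto_intros l)
  then have "norm (l - S 0) \<le> 2 * C"
    using bound[of 0] by (intro LIMSEQ_le_const2[of "\<lambda>n. norm (S n - S 0)"]) auto
  then show ?thesis using l by blast
qed

text \<open>The projection of \<open>U + V\<close> onto \<open>U\<close> along \<open>V\<close> is bounded.\<close>

lemma component_bounded_by_sum:
  fixes U V :: "'a::{real_normed_vector, complete_space} set"
  assumes "subspace U" "closed U" "subspace V" "closed V" "U \<inter> V = {0}"
    and "closed {u + v | u v. u \<in> U \<and> v \<in> V}"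
  shows "\<exists>C>0. \<forall>u\<in>U. \<forall>v\<in>V. norm u \<le> C * norm (u + v)"
proof -
  define W where "W = {u + v | u v. u \<in> U \<and> v \<in> V}"
  have sW: "subspace W" using subspace_sums[OF assms(1,3)] by (simp add: W_def)
  have UW: "U \<subseteq> W" "V \<subseteq> W"
    using subspace_0[OF assms(1)] subspace_0[OF assms(3)] by (force simp: W_def)+
  obtain K f g where K: "K \<ge> 0" and fg: "\<And>w. w \<in> W \<Longrightarrow> f w \<in> U \<and> g w \<in> V \<and>
      norm (f w) \<le> K * norm w \<and> norm (w - f w - g w) \<le> norm w / 2"
    using approximate_decomposition[OF assms(1,3,6)] unfolding W_def[symmetric] by metis
  have "norm u0 \<le> (2 * K + 1) * norm (u0 + v0)" if uv0: "u0 \<in> U" "v0 \<in> V" for u0 v0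
  proof -
    define w where "w = u0 + v0"
    have wW: "w \<in> W" using uv0 by (auto simp: w_def W_def)
    \<comment> \<open>Decompose approximately and repeat with the remainder, which is halved each time.\<close>
    define R where "R = rec_nat w (\<lambda>_ x. x - f x - g x)"
    have R0: "R 0 = w" and RS: "R (Suc k) = R k - f (R k) - g (R k)" for k
      by (auto simp: R_def)
    have RW: "R k \<in> W \<and> norm (R k) \<le> norm w / 2 ^ k" for k
    proof (induction k)
      case (Suc k)
      then have "f (R k) \<in> W" "g (R k) \<in> W" "norm (R (Suc k)) \<le> norm (R k) / 2"
        using fg[of "R k"] UW RS by auto
      with Suc show ?case using sW by (auto simp: RS subspace_diff)
    qed (simp add: R0 wW)
    define S where "S n = (\<Sum>k<n. f (R k))" for n
    have "norm (S (Suc k) - S k) \<le> (K * norm w) / 2 ^ k" for k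
    proof -
      have "norm (S (Suc k) - S k) \<le> K * norm (R k)" using fg RW by (simp add: S_def)
      also have "\<dots> \<le> K * (norm w / 2 ^ k)" using RW K by (intro mult_left_mono) auto
      finally show ?thesis by simp
    qed
    from geometric_increments_converge[of S, OF this]
    obtain u where u: "S \<longlonglongrightarrow> u" "norm u \<le> 2 * (K * norm w)" by (auto simp: S_def)
    have SU: "S n \<in> U" for n
      unfolding S_def using fg RW by (intro subspace_sum assms(1)) auto
    have uU: "u \<in> U" using closed_sequentially[OF assms(2)] SU u(1) by blast
    have tailV: "w - R n - S n \<in> V" for n
    proof -
      have "w - R n - S n = (\<Sum>k<n. g (R k))"
      proof (induction n)
        case (Suc n)
        then show ?case by (simp add: S_def RS algebra_simps)
      qed (simp add: S_def R0)
      then show ?thesis using fg RW by (simp add: subspace_sum[OF assms(3)])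
    qed
    have "R \<longlonglongrightarrow> 0"
      by (rule Lim_null_comparison[OF _ LIMSEQ_divide_realpow_zero[of 2 "norm w"]])
        (use RW in auto)
    then have "(\<lambda>n. w - R n - S n) \<longlonglongrightarrow> w - 0 - u" by (intro tendsto_intros u)
    then have "w - u \<in> V" using closed_sequentially[OF assms(4)] tailV by fastforce
    then have "(w - u) - v0 \<in> V" using uv0 assms(3) by (auto intro: subspace_diff)
    moreover have "(w - u) - v0 = u0 - u" by (simp add: w_def)
    moreover have "u0 - u \<in> U" using uv0 uU assms(1) by (auto intro: subspace_diff)
    ultimately have "u0 - u \<in> U \<inter> V" by simp
    then have "u0 = u" unfolding assms(5) by simp
    then have "norm u0 \<le> 2 * K * norm w" using u(2) by simp
    also have "\<dots> \<le> (2 * K + 1) * norm w" by (intro mult_right_mono) auto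
    finally show ?thesis by (simp add: w_def)
  qed
  moreover have "0 < 2 * K + 1" using K by simp
  ultimately show ?thesis by blast
qed

lemma positive_angle:
  fixes U V :: "'a::{real_inner, complete_space} set"
  assumes "subspace U" "closed U" "subspace V" "closed V" "U \<inter> V = {0}"
    and "closed {u + v | u v. u \<in> U \<and> v \<in> V}"
  shows "\<exists>\<gamma>\<ge>0. \<gamma> < 1 \<and> (\<forall>u\<in>U. \<forall>v\<in>V. u \<bullet> v \<le> \<gamma> * norm u * norm v)"
proof -
  obtain C where C: "C > 0" "\<And>u v. u \<in> U \<Longrightarrow> v \<in> V \<Longrightarrow> norm u \<le> C * norm (u + v)"
    using component_bounded_by_sum[OF assms] by blast
  \<comment> \<open>For unit vectors \<open>1 \<le> C\<^sup>2 \<parallel>s - t\<parallel>\<^sup>2 = 2 C\<^sup>2 (1 - s \<bullet> t)\<close>.\<close>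
  define \<gamma> where "\<gamma> = max 0 (1 - 1 / (2 * C\<^sup>2))"
  have "u \<bullet> v \<le> \<gamma> * norm u * norm v" if uv: "u \<in> U" "v \<in> V" for u v
  proof (cases "u = 0 \<or> v = 0")
    case False
    define s t where "s = (1 / norm u) *\<^sub>R u" and "t = (1 / norm v) *\<^sub>R v"
    have st: "norm s = 1" "norm t = 1" using False by (auto simp: s_def t_def)
    have "s \<in> U" "- t \<in> V"
      using uv assms(1,3) by (auto simp: s_def t_def intro!: subspace_mul subspace_neg)
    then have "1 \<le> C * norm (s - t)" using C(2)[of s "- t"] st by simp
    then have "1 \<le> (C * norm (s - t))\<^sup>2" by simp
    moreover have "(norm (s - t))\<^sup>2 = 2 - 2 * (s \<bullet> t)"
      using st by (simp add: power2_norm_eq_inner inner_diff_left inner_diff_right inner_commute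
          norm_eq_1)
    ultimately have "s \<bullet> t \<le> 1 - 1 / (2 * C\<^sup>2)"
      using C(1) by (simp add: field_simps)
    then have "s \<bullet> t \<le> \<gamma>" by (simp add: \<gamma>_def)
    then show ?thesis using False by (simp add: s_def t_def field_simps)
  qed auto
  moreover have "0 \<le> \<gamma>" "\<gamma> < 1" using C(1) by (auto simp: \<gamma>_def)
  ultimately show ?thesis by blast
qed

section \<open>Convex sets converging to a subspace\<close>

lemma infdist_le_aw_excess:
  fixes A C :: "'a::real_normed_vector set"
  assumes "x \<in> A" "norm x \<le> real N" "C \<noteq> {}"
  shows "infdist x C \<le> aw_excess N A C"
proof -
  have "infdist y C \<le> real N + infdist 0 C" if "norm y \<le> real N" for y
    using infdist_triangle[of y C 0] that by simp
  then have "bdd_above ((\<lambda>y. infdist y C) ` {y \<in> A. norm y \<le> real N})"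
    by (intro bdd_aboveI2) auto
  then have "infdist x C \<le> (SUP y\<in>{y \<in> A. norm y \<le> real N}. infdist y C)"
    by (rule cSUP_upper2[OF _ _ order_refl]) (use assms in auto)
  then show ?thesis using assms by (auto simp: aw_excess_def)
qed

lemma infdist_less_obtain:
  assumes "infdist x C < e" "C \<noteq> {}"
  obtains y where "y \<in> C" "dist x y < e"
proof -
  have "Inf (dist x ` C) < e" using assms by (simp add: infdist_notempty)
  then obtain y where "y \<in> C" "dist x y < e"
    using cInf_lessD[of "dist x ` C" e] assms(2) by blast
  then show thesis by (rule that)
qed

text \<open>Convexity turns closeness on the unit ball into closeness in proportion to the norm on the
  whole space.\<close>

lemma attouch_wets_subspace_cone:
  fixes U :: "'a::real_normed_vector set"
  assumes "subspace U" "attouch_wets_converges A U"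
    and A: "\<And>n. n \<ge> 1 \<Longrightarrow> A n \<noteq> {} \<and> convex (A n)"
    and "\<delta> > 0" "\<epsilon> > 0"
  shows "\<forall>\<^sub>F n in sequentially. (\<exists>p\<in>A n. norm p \<le> \<delta> * \<epsilon>) \<and>
    (\<forall>x\<in>A n. \<exists>u\<in>U. norm (x - u) \<le> \<delta> * max (norm x) \<epsilon>)"
proof -
  \<comment> \<open>The three bounds serve, in this order, the points of the unit ball, the rescaling of large
    points, and the requirement that the pulled-back point \<open>y\<close> below be in the unit ball.\<close>
  define \<eta> where "\<eta> = Min {\<delta> * \<epsilon>, \<delta> / 4, 1 / 2}"
  have \<eta>: "\<eta> > 0" "\<eta> \<le> \<delta> * \<epsilon>" "\<eta> \<le> \<delta> / 4" "\<eta> \<le> 1 / 2"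
    using assms by (auto simp: \<eta>_def)
  have U0: "0 \<in> U" using subspace_0[OF assms(1)] .
  have "(\<lambda>n. aw_dist 1 (A n) U) \<longlonglongrightarrow> 0"
    using assms(2) by (simp add: attouch_wets_converges_def)
  then have "\<forall>\<^sub>F n in sequentially. aw_dist 1 (A n) U < \<eta>"
    using \<eta>(1) by (rule order_tendstoD)
  then show ?thesis
    using eventually_ge_at_top[of 1]
  proof eventually_elim
    case (elim n)
    then have exc: "aw_excess 1 (A n) U < \<eta>" "aw_excess 1 U (A n) < \<eta>"
      and An: "A n \<noteq> {}" "convex (A n)" using A by (auto simp: aw_dist_def)
    have "infdist 0 (A n) < \<eta>"
      using infdist_le_aw_excess[of 0 U 1 "A n"] U0 An exc by simp
    then obtain p where p: "p \<in> A n" "norm p < \<eta>"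
      using infdist_less_obtain[OF _ An(1)] by (metis dist_0_norm)
    have nearU: "\<exists>u\<in>U. norm (x - u) < \<eta>" if "x \<in> A n" "norm x \<le> 1" for x
    proof -
      have "infdist x U < \<eta>"
        using infdist_le_aw_excess[of x "A n" 1 U] that U0 exc by force
      then show ?thesis using infdist_less_obtain[of x U \<eta>] U0 by (auto simp: dist_norm)
    qed
    have "\<exists>u\<in>U. norm (x - u) \<le> \<delta> * max (norm x) \<epsilon>" if x: "x \<in> A n" for x
    proof (cases "norm x \<le> 1")
      case True
      then obtain u where "u \<in> U" "norm (x - u) < \<eta>" using nearU x by blast
      moreover have "\<delta> * \<epsilon> \<le> \<delta> * max (norm x) \<epsilon>" using assms by simp
      ultimately have "norm (x - u) \<le> \<delta> * max (norm x) \<epsilon>" using \<eta>(2) by linarith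
      with \<open>u \<in> U\<close> show ?thesis by blast
    next
      case False
      define t where "t = 1 / (2 * norm x)"
      have t: "0 < t" "t \<le> 1" "t * norm x = 1 / 2" using False by (auto simp: t_def divide_simps)
      define y where "y = (1 - t) *\<^sub>R p + t *\<^sub>R x"
      have "y \<in> A n" unfolding y_def using convexD_alt[OF An(2) p(1) x] t by simp
      have tp: "norm ((1 - t) *\<^sub>R p) \<le> norm p"
        using t by (simp add: mult_left_le_one_le)
      then have "norm y \<le> 1"
        using norm_triangle_ineq[of "(1 - t) *\<^sub>R p" "t *\<^sub>R x"] t p(2) \<eta>(4) by (simp add: y_def)
      then obtain u where u: "u \<in> U" "norm (y - u) < \<eta>" using nearU \<open>y \<in> A n\<close> by blast
      have "x - (1/t) *\<^sub>R u = (1/t) *\<^sub>R ((y - u) - (1 - t) *\<^sub>R p)"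
        using t by (simp add: y_def scaleR_diff_right)
      then have "norm (x - (1/t) *\<^sub>R u) = (1/t) * norm ((y - u) - (1 - t) *\<^sub>R p)"
        using t by simp
      also have "\<dots> \<le> (1/t) * (2 * \<eta>)"
        using norm_triangle_ineq4[of "y - u" "(1 - t) *\<^sub>R p"] tp p(2) u(2) t
        by (intro mult_left_mono) auto
      also have "\<dots> = 4 * \<eta> * norm x" by (simp add: t_def)
      also have "\<dots> \<le> \<delta> * max (norm x) \<epsilon>"
        using \<eta> assms by (intro mult_mono) auto
      finally show ?thesis using u(1) subspace_mul[OF assms(1)] by blast
    qed
    moreover have "norm p \<le> \<delta> * \<epsilon>" using p(2) \<eta>(2) by simp
    ultimately show ?case using p(1) by blast
  qed
qed

section \<open>Contraction of the norms\<close>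

text \<open>One projection step: \<open>x\<close> plays the projection of \<open>y\<close> onto a convex set containing
  the small vector \<open>p\<close>; \<open>u\<close> and \<open>v\<close> are nearby points of the two subspaces.\<close>

lemma projection_step_bound:
  fixes x y p u v :: "'a::real_inner"
  assumes vi: "(y - x) \<bullet> (p - x) \<le> 0"
    and p: "norm p \<le> \<delta> * \<epsilon>"
    and xu: "norm (x - u) \<le> \<delta> * max (norm x) \<epsilon>"
    and yv: "norm (y - v) \<le> \<delta> * max (norm y) \<epsilon>"
    and angle: "u \<bullet> v \<le> \<gamma> * norm u * norm v"
    and "0 \<le> \<gamma>" "\<gamma> \<le> 1" "0 < \<delta>" "\<delta> \<le> 1" "0 < \<epsilon>" "\<gamma> + 8 * \<delta> \<le> q" "q \<le> 1"
  shows "norm x \<le> max \<epsilon> (q * norm y)"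
proof -
  define X Y where "X = max (norm x) \<epsilon>" and "Y = max (norm y) \<epsilon>"
  have XY: "X > 0" "Y > 0" "norm x \<le> X" "norm y \<le> Y" "\<epsilon> \<le> X" "\<epsilon> \<le> Y"
    using assms by (auto simp: X_def Y_def)
  have u: "norm u \<le> (1 + \<delta>) * X" and v: "norm v \<le> (1 + \<delta>) * Y"
    using norm_triangle_ineq4[of x "x - u"] norm_triangle_ineq4[of y "y - v"] xu yv XY
    by (auto simp: X_def[symmetric] Y_def[symmetric] algebra_simps)
  have "\<gamma> * norm u * norm v \<le> \<gamma> * ((1 + \<delta>) * X) * ((1 + \<delta>) * Y)"
    using u v XY assms by (intro mult_mono mult_left_mono) auto
  also have "\<dots> = (\<gamma> * (1 + \<delta>)\<^sup>2) * (X * Y)" by (simp add: power2_eq_square)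
  also have "\<dots> \<le> (\<gamma> + 3 * \<delta>) * (X * Y)"
  proof -
    have "\<delta> * \<delta> \<le> \<delta>" using assms by (simp add: mult_left_le_one_le)
    then have "\<gamma> * (2 * \<delta> + \<delta> * \<delta>) \<le> 1 * (3 * \<delta>)" using assms by (intro mult_mono) auto
    then have "\<gamma> * (1 + \<delta>)\<^sup>2 \<le> \<gamma> + 3 * \<delta>" by (simp add: power2_eq_square algebra_simps)
    then show ?thesis using XY by (intro mult_right_mono) auto
  qed
  finally have 1: "u \<bullet> v \<le> (\<gamma> + 3 * \<delta>) * (X * Y)" using angle by simp
  have "(x - u) \<bullet> y \<le> norm (x - u) * norm y" by (rule norm_cauchy_schwarz)
  also have "\<dots> \<le> (\<delta> * X) * Y" using xu XY assms by (intro mult_mono) (auto simp: X_def)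
  finally have 2: "(x - u) \<bullet> y \<le> \<delta> * (X * Y)" by simp
  have "u \<bullet> (y - v) \<le> norm u * norm (y - v)" by (rule norm_cauchy_schwarz)
  also have "\<dots> \<le> (2 * X) * (\<delta> * Y)"
  proof (intro mult_mono)
    have "(1 + \<delta>) * X \<le> 2 * X" using XY assms by (intro mult_right_mono) auto
    then show "norm u \<le> 2 * X" using u by simp
  qed (use yv XY assms in \<open>auto simp: Y_def\<close>)
  finally have 3: "u \<bullet> (y - v) \<le> 2 * (\<delta> * (X * Y))" by (simp add: mult_ac)
  have "x \<bullet> p \<le> norm x * norm p" by (rule norm_cauchy_schwarz)
  also have "\<dots> \<le> X * (\<delta> * Y)"
    using XY p assms order_trans[OF p mult_left_mono[of \<epsilon> Y \<delta>]] by (intro mult_mono) auto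
  finally have 4: "x \<bullet> p \<le> \<delta> * (X * Y)" by (simp add: mult_ac)
  have "- (y \<bullet> p) \<le> norm y * norm p" using norm_cauchy_schwarz[of "- y" p] by simp
  also have "\<dots> \<le> Y * (\<delta> * X)"
    using XY p assms order_trans[OF p mult_left_mono[of \<epsilon> X \<delta>]] by (intro mult_mono) auto
  finally have 5: "- (y \<bullet> p) \<le> \<delta> * (X * Y)" by (simp add: mult_ac)
  have "(norm x)\<^sup>2 \<le> x \<bullet> y + x \<bullet> p - y \<bullet> p"
    using vi by (simp add: power2_norm_eq_inner inner_diff_left inner_diff_right inner_commute)
  moreover have "x \<bullet> y = u \<bullet> v + (x - u) \<bullet> y + u \<bullet> (y - v)"
    by (simp add: inner_diff_left inner_diff_right)
  ultimately have "(norm x)\<^sup>2 \<le> (\<gamma> + 3 * \<delta>) * (X * Y) + 5 * (\<delta> * (X * Y))"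
    using 1 2 3 4 5 by linarith
  also have "\<dots> = (\<gamma> + 8 * \<delta>) * (X * Y)" by (simp add: algebra_simps)
  also have "\<dots> \<le> q * (X * Y)" using XY assms by (intro mult_right_mono) auto
  finally have main: "(norm x)\<^sup>2 \<le> q * (X * Y)" .
  show ?thesis
  proof (cases "norm x \<le> \<epsilon>")
    case False
    then have "X = norm x" by (simp add: X_def)
    then have "norm x * norm x \<le> norm x * (q * Y)" using main by (simp add: power2_eq_square mult_ac)
    then have "norm x \<le> q * Y" by (rule mult_left_le_imp_le) (use False \<open>0 < \<epsilon>\<close> in linarith)
    moreover have "q * \<epsilon> \<le> \<epsilon>" using assms by (simp add: mult_left_le_one_le)
    then have "q * Y \<le> max (q * norm y) \<epsilon>" by (auto simp: Y_def max_def)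
    ultimately show ?thesis by (simp add: max.commute)
  qed simp
qed

lemma geometric_decay_to_threshold:
  fixes s :: "nat \<Rightarrow> real"
  assumes "\<And>n. n \<ge> M \<Longrightarrow> s (Suc n) \<le> max \<epsilon> (q * s n)" "0 \<le> q" "q < 1" "0 < \<epsilon>"
  shows "\<forall>\<^sub>F n in sequentially. s n \<le> \<epsilon>"
proof -
  have bound: "s (k + M) \<le> max \<epsilon> (q ^ k * s M)" for k
  proof (induction k)
    case (Suc k)
    have "q * s (k + M) \<le> q * max \<epsilon> (q ^ k * s M)" using Suc assms by (intro mult_left_mono) auto
    also have "\<dots> = max (q * \<epsilon>) (q ^ Suc k * s M)"
      using assms by (simp add: max_mult_distrib_left mult_ac)
    also have "\<dots> \<le> max \<epsilon> (q ^ Suc k * s M)"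
      using assms by (intro max.mono) (auto simp: mult_left_le_one_le)
    finally show ?case using assms(1)[of "k + M"] by simp
  qed simp
  have "(\<lambda>k. q ^ k * s M) \<longlonglongrightarrow> 0 * s M"
    using assms by (intro tendsto_intros LIMSEQ_realpow_zero)
  then have "\<forall>\<^sub>F k in sequentially. q ^ k * s M < \<epsilon>" using assms by (intro order_tendstoD) auto
  then have "\<forall>\<^sub>F k in sequentially. s (k + M) \<le> \<epsilon>"
    by eventually_elim (use bound in \<open>force simp: le_max_iff_disj\<close>)
  then show ?thesis using eventually_sequentially_seg[of "\<lambda>n. s n \<le> \<epsilon>"] by blast
qed

section \<open>Convergence of the perturbed alternating projections\<close>

theorem theorem5p2:
  fixes U V :: "'a::{real_inner, complete_space} set"
    and A B :: "nat \<Rightarrow> 'a set"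
    and a0 :: 'a
    and a b :: "nat \<Rightarrow> 'a"
  assumes "subspace U" and "closed U"
    and "subspace V" and "closed V"
    and "U \<inter> V = {0}"
    and "closed {u + v | u v. u \<in> U \<and> v \<in> V}"
    and "\<And>n. n \<ge> 1 \<Longrightarrow> A n \<noteq> {} \<and> closed (A n) \<and> convex (A n)"
    and "\<And>n. n \<ge> 1 \<Longrightarrow> B n \<noteq> {} \<and> closed (B n) \<and> convex (B n)"
    and "attouch_wets_converges A U"
    and "attouch_wets_converges B V"
    and "perturbed_alternating_projections A B a0 a b"
  shows "a \<longlonglongrightarrow> 0 \<and> b \<longlonglongrightarrow> 0"
proof -
  obtain \<gamma> where \<gamma>: "0 \<le> \<gamma>" "\<gamma> < 1"
    and angle: "\<And>u v. u \<in> U \<Longrightarrow> v \<in> V \<Longrightarrow> u \<bullet> v \<le> \<gamma> * norm u * norm v"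
    using positive_angle[OF assms(1-6)] by blast
  \<comment> \<open>Chosen so that \<open>\<gamma> + 8 * \<delta> = q\<close>.\<close>
  define q where "q = (1 + \<gamma>) / 2"
  define \<delta> where "\<delta> = (1 - \<gamma>) / 16"
  have q: "0 \<le> q" "q < 1" "\<gamma> + 8 * \<delta> \<le> q" and \<delta>: "0 < \<delta>" "\<delta> \<le> 1"
    using \<gamma> by (auto simp: q_def \<delta>_def field_simps)
  have rec: "b n = metric_projection (B n) (a (n - 1))" "a n = metric_projection (A n) (b n)"
    if "n \<ge> 1" for n
    using assms(11) that by (auto simp: perturbed_alternating_projections_def)
  have aA: "a n \<in> A n" and avi: "\<And>z. z \<in> A n \<Longrightarrow> (b n - a n) \<bullet> (z - a n) \<le> 0"
    and bB: "b n \<in> B n" and bvi: "\<And>z. z \<in> B n \<Longrightarrow> (a (n - 1) - b n) \<bullet> (z - b n) \<le> 0"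
    if "n \<ge> 1" for n
    using metric_projection_variational[of "A n"] metric_projection_variational[of "B n"]
      assms(7)[OF that] assms(8)[OF that] rec[OF that] by auto
  have main: "(\<forall>\<^sub>F n in sequentially. norm (a n) \<le> \<epsilon>) \<and> (\<forall>\<^sub>F n in sequentially. norm (b n) \<le> \<epsilon>)"
    if \<epsilon>: "0 < \<epsilon>" for \<epsilon>
  proof -
    have "\<forall>\<^sub>F n in sequentially.
        ((\<exists>p\<in>A n. norm p \<le> \<delta> * \<epsilon>) \<and> (\<forall>x\<in>A n. \<exists>u\<in>U. norm (x - u) \<le> \<delta> * max (norm x) \<epsilon>)) \<and>
        ((\<exists>p\<in>B n. norm p \<le> \<delta> * \<epsilon>) \<and> (\<forall>x\<in>B n. \<exists>u\<in>V. norm (x - u) \<le> \<delta> * max (norm x) \<epsilon>)) \<and>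
        n \<ge> 1"
      using assms(7,8) \<delta>(1) \<epsilon>
      by (intro eventually_conj attouch_wets_subspace_cone assms(1,3,9,10) eventually_ge_at_top) auto
    then obtain M where M: "\<And>n. n \<ge> M \<Longrightarrow>
        ((\<exists>p\<in>A n. norm p \<le> \<delta> * \<epsilon>) \<and> (\<forall>x\<in>A n. \<exists>u\<in>U. norm (x - u) \<le> \<delta> * max (norm x) \<epsilon>)) \<and>
        ((\<exists>p\<in>B n. norm p \<le> \<delta> * \<epsilon>) \<and> (\<forall>x\<in>B n. \<exists>u\<in>V. norm (x - u) \<le> \<delta> * max (norm x) \<epsilon>)) \<and>
        n \<ge> 1"
      unfolding eventually_sequentially by blast
    have stepA: "norm (a n) \<le> max \<epsilon> (q * norm (b n))" if n: "n \<ge> M" for n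
    proof -
      have n1: "n \<ge> 1" using M[OF n] by blast
      obtain p u v where "p \<in> A n" "norm p \<le> \<delta> * \<epsilon>"
        "u \<in> U" "norm (a n - u) \<le> \<delta> * max (norm (a n)) \<epsilon>"
        "v \<in> V" "norm (b n - v) \<le> \<delta> * max (norm (b n)) \<epsilon>"
        using M[OF n] aA[OF n1] bB[OF n1] by blast
      then show ?thesis using \<gamma> q \<delta> \<epsilon>
        by (intro projection_step_bound[OF avi[OF n1] _ _ _ angle]) auto
    qed
    have stepB: "norm (b (Suc n)) \<le> max \<epsilon> (q * norm (a n))" if n: "n \<ge> M" for n
    proof -
      have n1: "n \<ge> 1" "Suc n \<ge> 1" "Suc n \<ge> M" using M[OF n] n by auto
      obtain p u v where "p \<in> B (Suc n)" "norm p \<le> \<delta> * \<epsilon>"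
        "u \<in> U" "norm (a n - u) \<le> \<delta> * max (norm (a n)) \<epsilon>"
        "v \<in> V" "norm (b (Suc n) - v) \<le> \<delta> * max (norm (b (Suc n))) \<epsilon>"
        using M[OF n] M[OF n1(3)] aA[OF n1(1)] bB[OF n1(2)] by blast
      moreover have "v \<bullet> u \<le> \<gamma> * norm v * norm u"
        using angle[OF \<open>u \<in> U\<close> \<open>v \<in> V\<close>] by (simp add: inner_commute mult_ac)
      moreover have "(a n - b (Suc n)) \<bullet> (p - b (Suc n)) \<le> 0"
        using bvi[OF n1(2) \<open>p \<in> B (Suc n)\<close>] by simp
      ultimately show ?thesis using \<gamma> q \<delta> \<epsilon>
        by (intro projection_step_bound[where p = p and u = v and v = u]) auto
    qed
    have shrink: "q * t \<le> max \<epsilon> r" if "t \<le> max \<epsilon> r" "0 \<le> t" for t r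
      using that q by (meson mult_left_le_one_le order_trans less_imp_le)
    have "norm (a (Suc n)) \<le> max \<epsilon> (q * norm (a n))" if n: "n \<ge> M" for n
      using stepA[of "Suc n"] shrink[OF stepB[OF n]] n by auto
    then have a: "\<forall>\<^sub>F n in sequentially. norm (a n) \<le> \<epsilon>"
      using q \<epsilon> by (intro geometric_decay_to_threshold[of M _ \<epsilon> q]) auto
    then have "\<forall>\<^sub>F n in sequentially. norm (b (Suc n)) \<le> \<epsilon>"
      using eventually_ge_at_top[of M]
    proof eventually_elim
      case (elim n)
      then show ?case using stepB[of n] shrink[of "norm (a n)" \<epsilon>] by auto
    qed
    then have "\<forall>\<^sub>F n in sequentially. norm (b n) \<le> \<epsilon>"
      using eventually_sequentially_Suc[of "\<lambda>n. norm (b n) \<le> \<epsilon>"] by blast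
    with a show ?thesis by blast
  qed
  have null: "c \<longlonglongrightarrow> 0" if "\<And>\<epsilon>. 0 < \<epsilon> \<Longrightarrow> \<forall>\<^sub>F n in sequentially. norm (c n) \<le> \<epsilon>" for c :: "nat \<Rightarrow> 'a"
  proof (rule tendstoI)
    fix e :: real assume "0 < e"
    then have "\<forall>\<^sub>F n in sequentially. norm (c n) \<le> e / 2" using that[of "e / 2"] by simp
    then show "\<forall>\<^sub>F n in sequentially. dist (c n) 0 < e"
      by eventually_elim (use \<open>0 < e\<close> in simp)
  qed
  show ?thesis using null[of a] null[of b] main by blast
qed

end
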